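(* Let $\mathcal{P}$ be a finite index set, $\{A_p : p\in\mathcal{P}\}$ a collection of real $n\times n$ matrices, and $\mathcal{I}=\{I_q : q\in\mathcal{Q}\}$ a compact set of real $n\times n$ matrices. Assume that for some $\tau>0$ there exists a collection of symmetric positive definite matrices $\{Q_p\in M_n(\mathbb{R}) : p\in\mathcal{P}\}$ such that $$Q_pA_p+A_p^\top Q_p<0\quad\text{for all }p\in\mathcal{P},\qquad e^{A_q^\top\tau}M^\top Q_pMe^{A_q\tau}\le Q_q\quad\text{for all }p,q\in\mathcal{P}\text{ and }M\in\mathcal{I}.$$ Then for all signals $\sigma\in\mathcal{S}_s[\tau]$ the impulsive switched system $\dot x(t)=A_{\sigma(t)}x(t)$, $x(t_k)=I_{\omega(t_k)}\,x(t_k^-)$ ($k\ge1$) is stable under arbitrary impulses, i.e. stable for every function $\omega:\{t_1,t_2,\dots\}\to\mathcal{Q}$.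
   Context: For symmetric matrices, $<$ and $\le$ denote the (strict and non-strict) Loewner order. A switching signal is a right-continuous piecewise constant function $\sigma:[0,\infty)\to\mathcal{P}$ whose set of discontinuities $\{t_k\}_{k\ge1}$ (switching times) is an increasing sequence with $t_k\uparrow\infty$; put $t_0=0$. $\mathcal{S}_s[\tau]$ is the set of switching signals with $t_k-t_{k-1}\ge\tau$ for all $k\ge1$. In the impulsive switched system, $\dot x=A_{\sigma(t)}x$ holds on each $[t_{k-1},t_k)$ and $x(t_k^-)=\lim_{t\to t_k^-}x(t)$. The system (for fixed $\sigma,\omega$) is stable if for every $\epsilon>0$ there is $\delta>0$ such that $\|x(0)\|<\delta$ implies $\|x(t)\|<\epsilon$ for all $t>0$ (Euclidean norm). *)

theory Defs
  imports "HOL-Analysis.Analysis"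
begin

section \<open>Matrix exponential and Loewner order\<close>

definition matrix_power :: "real ^ 'n ^ 'n \<Rightarrow> nat \<Rightarrow> real ^ 'n ^ 'n"
  where "matrix_power A k = (((**) A) ^^ k) (mat 1)"

text \<open>The square matrices \<^typ>\<open>real ^ 'n ^ 'n\<close> are not an instance of
  \<^class>\<open>real_normed_algebra_1\<close>, so the library exponential does not apply to them. The
  series below converges for every matrix, see \<open>summable_matrix_exp\<close>.\<close>

definition matrix_exp :: "real ^ 'n ^ 'n \<Rightarrow> real ^ 'n ^ 'n"
  where "matrix_exp A = (\<Sum>k. matrix_power A k /\<^sub>R fact k)"

lemma summable_matrix_exp:
  fixes A :: "real ^ 'n ^ 'n"
  shows "summable (\<lambda>k. matrix_power A k /\<^sub>R fact k)"
proof -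
  have "linear (\<lambda>B :: real ^ 'n ^ 'n. A ** B)"
    by (intro linearI) (simp_all add: matrix_add_ldistrib matrix_scalar_ac scalar_matrix_assoc
      flip: scalar_mult_eq_scaleR)
  then obtain K where K: "\<And>B :: real ^ 'n ^ 'n. norm (A ** B) \<le> K * norm B" "K > 0"
    using linear_bounded_pos by blast
  have bound: "norm (matrix_power A k) \<le> K ^ k * norm (mat 1 :: real ^ 'n ^ 'n)" for k
  proof (induction k)
    case (Suc k)
    have "norm (matrix_power A (Suc k)) \<le> K * norm (matrix_power A k)"
      using K(1) by (simp add: matrix_power_def)
    also have "\<dots> \<le> K * (K ^ k * norm (mat 1 :: real ^ 'n ^ 'n))"
      using Suc K(2) by simp
    finally show ?case by simp
  qed (simp add: matrix_power_def)
  have "summable (\<lambda>k. K ^ k /\<^sub>R fact k * norm (mat 1 :: real ^ 'n ^ 'n))"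
    by (intro summable_mult2 summable_exp_generic)
  then show ?thesis
    by (rule summable_comparison_test[rotated])
       (use bound in \<open>auto intro!: exI[of _ 0] simp: field_simps\<close>)
qed

definition symmetric_matrix :: "real ^ 'n ^ 'n \<Rightarrow> bool"
  where "symmetric_matrix A \<longleftrightarrow> transpose A = A"

definition positive_definite :: "real ^ 'n ^ 'n \<Rightarrow> bool"
  where "positive_definite A \<longleftrightarrow> symmetric_matrix A \<and> (\<forall>v. v \<noteq> 0 \<longrightarrow> v \<bullet> (A *v v) > 0)"

definition positive_semidefinite :: "real ^ 'n ^ 'n \<Rightarrow> bool"
  where "positive_semidefinite A \<longleftrightarrow> symmetric_matrix A \<and> (\<forall>v. v \<bullet> (A *v v) \<ge> 0)"

text \<open>The notation \<open><\<close>, \<open>\<le>\<close> on vectors and matrices denotes the componentwise order in the library.\<close>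

definition loewner_less :: "real ^ 'n ^ 'n \<Rightarrow> real ^ 'n ^ 'n \<Rightarrow> bool"  (infix "<\<^sub>L" 50)
  where "A <\<^sub>L B \<longleftrightarrow> symmetric_matrix A \<and> symmetric_matrix B \<and> positive_definite (B - A)"

definition loewner_le :: "real ^ 'n ^ 'n \<Rightarrow> real ^ 'n ^ 'n \<Rightarrow> bool"  (infix "\<le>\<^sub>L" 50)
  where "A \<le>\<^sub>L B \<longleftrightarrow> symmetric_matrix A \<and> symmetric_matrix B \<and> positive_semidefinite (B - A)"


section \<open>Switching signals\<close>

text \<open>Signals live on \<open>[0, \<infinity>)\<close>; the values of \<open>\<sigma>\<close> at negative times are irrelevant. The index
  type \<open>'p\<close> carries the discrete topology, so a limit \<open>\<sigma> u \<longlongrightarrow> \<sigma> s\<close> means that \<open>\<sigma> u = \<sigma> s\<close>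
  eventually.\<close>

definition signal_discontinuities :: "(real \<Rightarrow> 'p) \<Rightarrow> real set"
  where "signal_discontinuities \<sigma> =
    {s. 0 \<le> s \<and> \<not> (\<forall>\<^sub>F u in at s within {0..}. \<sigma> u = \<sigma> s)}"

text \<open>\<open>t 1 < t 2 < \<dots>\<close> are the switching times of \<open>\<sigma>\<close>, and \<open>t 0 = 0\<close>.\<close>

definition switching_signal :: "'p set \<Rightarrow> (real \<Rightarrow> 'p) \<Rightarrow> (nat \<Rightarrow> real) \<Rightarrow> bool"
  where "switching_signal P \<sigma> t \<longleftrightarrow>
    \<sigma> \<in> {0..} \<rightarrow> P \<and>
    t 0 = 0 \<and> strict_mono t \<and> filterlim t at_top sequentially \<and>
    signal_discontinuities \<sigma> = t ` {1..} \<and>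
    (\<forall>s\<ge>0. \<forall>\<^sub>F u in at_right s. \<sigma> u = \<sigma> s) \<and>
    (\<forall>k\<ge>1. \<sigma> constant_on {t (k - 1)<..<t k})"

text \<open>The class \<open>\<S>\<^sub>s[\<tau>]\<close> of signals with dwell time at least \<open>\<tau>\<close>. A signal is paired with its
  sequence of switching times, which it determines uniquely.\<close>

definition dwell_time_signals :: "'p set \<Rightarrow> real \<Rightarrow> ((real \<Rightarrow> 'p) \<times> (nat \<Rightarrow> real)) set"
  where "dwell_time_signals P \<tau> =
    {(\<sigma>, t). switching_signal P \<sigma> t \<and> (\<forall>k\<ge>1. t k - t (k - 1) \<ge> \<tau>)}"


section \<open>Impulsive switched systems\<close>

text \<open>At the left end point of \<open>[t\<^sub>k\<^sub>-\<^sub>1, t\<^sub>k)\<close> the differential equation holds for the right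
  derivative; \<open>l\<close> is the left limit \<open>x(t\<^sub>k\<^sup>-)\<close>.\<close>

definition impulsive_solution ::
  "('p \<Rightarrow> real ^ 'n ^ 'n) \<Rightarrow> ('q \<Rightarrow> real ^ 'n ^ 'n) \<Rightarrow> (real \<Rightarrow> 'p) \<Rightarrow> (nat \<Rightarrow> real) \<Rightarrow>
    (real \<Rightarrow> 'q) \<Rightarrow> (real \<Rightarrow> real ^ 'n) \<Rightarrow> bool"
  where "impulsive_solution A J \<sigma> t \<omega> x \<longleftrightarrow>
    (\<forall>k\<ge>1. \<forall>s\<in>{t (k - 1)..<t k}.
       (x has_vector_derivative A (\<sigma> s) *v x s) (at s within {t (k - 1)..<t k})) \<and>
    (\<forall>k\<ge>1. \<exists>l. (x \<longlongrightarrow> l) (at_left (t k)) \<and> x (t k) = J (\<omega> (t k)) *v l)"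

definition impulsive_stable ::
  "('p \<Rightarrow> real ^ 'n ^ 'n) \<Rightarrow> ('q \<Rightarrow> real ^ 'n ^ 'n) \<Rightarrow> (real \<Rightarrow> 'p) \<Rightarrow> (nat \<Rightarrow> real) \<Rightarrow>
    (real \<Rightarrow> 'q) \<Rightarrow> bool"
  where "impulsive_stable A J \<sigma> t \<omega> \<longleftrightarrow>
    (\<forall>\<epsilon>>0. \<exists>\<delta>>0. \<forall>x. impulsive_solution A J \<sigma> t \<omega> x \<longrightarrow>
       norm (x 0) < \<delta> \<longrightarrow> (\<forall>s>0. norm (x s) < \<epsilon>))"

end

theory Submission
  imports Defs
begin

text \<open>Along a solution the quadratic form \<open>V s = x s \<bullet> (Q (\<sigma> s) *v x s)\<close> never exceeds its initial
  value. Between switching times it decreases by the Lyapunov inequality. The left limit at a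
  switching time \<open>t\<^sub>k\<close> is \<open>e\<^bsup>\<tau>A\<^esup> y\<close> with \<open>y = x (t\<^sub>k - \<tau>)\<close>, a state that the dwell time places in the
  preceding interval, so the second matrix inequality bounds the value after the jump by the value
  of the old form at \<open>y\<close>. As there are finitely many forms, they are uniformly comparable to the
  squared norm.\<close>

section \<open>The matrix exponential\<close>

lemma matrix_mult_scaleR_right: "A ** (c *\<^sub>R B) = c *\<^sub>R (A ** B :: real ^ 'n ^ 'm)"
  by (simp add: matrix_scalar_ac scalar_matrix_assoc flip: scalar_mult_eq_scaleR)

lemma matrix_mult_scaleR_left: "(c *\<^sub>R A) ** B = c *\<^sub>R (A ** B :: real ^ 'n ^ 'm)"
  by (simp add: scalar_matrix_assoc flip: scalar_mult_eq_scaleR)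

lemma transpose_scaleR: "transpose (c *\<^sub>R A) = c *\<^sub>R transpose A"
  by (simp add: transpose_def vec_eq_iff)

lemma bounded_linear_matrix_mult_left:
  "bounded_linear (\<lambda>B. A ** B :: real ^ 'n ^ 'n)"
  by (intro linear_conv_bounded_linear[THEN iffD1] linearI)
    (simp_all add: matrix_add_ldistrib matrix_mult_scaleR_right)

lemma bounded_linear_matrix_mult_right:
  "bounded_linear (\<lambda>B. B ** A :: real ^ 'n ^ 'n)"
  by (intro linear_conv_bounded_linear[THEN iffD1] linearI)
    (simp_all add: matrix_mult_scaleR_left,
      simp add: matrix_matrix_mult_def vec_eq_iff algebra_simps sum.distrib)

lemma bounded_linear_transpose: "bounded_linear (transpose :: real ^ 'n ^ 'n \<Rightarrow> real ^ 'n ^ 'n)"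
  by (intro linear_conv_bounded_linear[THEN iffD1] linearI)
    (simp_all add: transpose_def vec_eq_iff)

text \<open>In finite dimension bilinearity already implies boundedness. This opens the way to the
  product rule and the limit rule for \<open>E s *v x s\<close> in
  \<open>linear_ode_left_limit\<close>.\<close>

lemma bounded_bilinear_matrix_vector_mult:
  "bounded_bilinear ((*v) :: real ^ 'n ^ 'm \<Rightarrow> real ^ 'n \<Rightarrow> real ^ 'm)"
proof -
  have "linear (\<lambda>A :: real ^ 'n ^ 'm. A *v v)" for v :: "real ^ 'n"
    by (intro linearI) (simp_all add: matrix_vector_mult_add_rdistrib scaleR_matrix_vector_assoc)
  then show ?thesis
    by (simp add: bilinear_conv_bounded_bilinear[symmetric] bilinear_def)
qed

section \<open>Matrix powers and the exponential series\<close>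

lemma matrix_power_0 [simp]: "matrix_power A 0 = mat 1"
  by (simp add: matrix_power_def)

lemma matrix_power_Suc: "matrix_power A (Suc k) = A ** matrix_power A k"
  by (simp add: matrix_power_def)

lemma matrix_power_Suc2: "matrix_power A (Suc k) = matrix_power A k ** A"
  by (induction k) (simp_all add: matrix_power_Suc matrix_mul_assoc)

lemma transpose_matrix_power: "transpose (matrix_power A k) = matrix_power (transpose A) k"
proof (induction k)
  case (Suc k)
  then show ?case
    by (simp add: matrix_power_Suc2[of A] matrix_power_Suc[of "transpose A"] matrix_transpose_mul)
qed (simp add: transpose_mat)

lemma matrix_power_scaleR:
  "matrix_power (s *\<^sub>R A) k = s ^ k *\<^sub>R matrix_power A k"
proof (induction k)
  case (Suc k)
  then show ?case
    by (simp add: matrix_power_Suc matrix_mult_scaleR_right matrix_mult_scaleR_left mult.commute)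
qed simp

text \<open>Transposition is bounded linear, so it passes through the series term by term. It lets
  the jump inequality be read as a congruence by
  \<open>M ** matrix_exp (\<tau> *\<^sub>R A q)\<close>.\<close>

lemma transpose_matrix_exp: "transpose (matrix_exp A) = matrix_exp (transpose A)"
  by (simp add: matrix_exp_def transpose_matrix_power
      bounded_linear.suminf[OF bounded_linear_transpose summable_matrix_exp] transpose_scaleR)

text \<open>Multiplying the series by \<open>A\<close> on either side gives the same terms, each
  with \<open>matrix_power A (Suc k)\<close>.\<close>

lemma matrix_exp_commute: "A ** matrix_exp (s *\<^sub>R A) = matrix_exp (s *\<^sub>R A) ** A"
  unfolding matrix_exp_def bounded_linear.suminf[OF bounded_linear_matrix_mult_left summable_matrix_exp]
    bounded_linear.suminf[OF bounded_linear_matrix_mult_right summable_matrix_exp]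
  by (simp add: matrix_mult_scaleR_right matrix_mult_scaleR_left matrix_power_scaleR
      flip: matrix_power_Suc matrix_power_Suc2)

lemma matrix_exp_0 [simp]: "matrix_exp (0 :: real ^ 'n ^ 'n) = mat 1"
proof -
  have "matrix_power (0 :: real ^ 'n ^ 'n) k /\<^sub>R fact k = (if k = 0 then mat 1 else 0)" for k
    by (cases k) (simp_all add: matrix_power_Suc matrix_matrix_mult_def vec_eq_iff)
  then have "(\<lambda>k. matrix_power (0 :: real ^ 'n ^ 'n) k /\<^sub>R fact k) sums mat 1"
    using sums_single[of 0 "\<lambda>_. mat 1 :: real ^ 'n ^ 'n"] by simp
  then show ?thesis
    by (simp add: matrix_exp_def sums_iff)
qed

text \<open>The inner product with a fixed matrix \<open>b\<close> is an everywhere convergent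
  scalar power series in \<open>s\<close>, which can be differentiated termwise; letting
  \<open>b\<close> run through the basis gives the derivative of the whole.\<close>

lemma has_vector_derivative_matrix_exp:
  fixes A :: "real ^ 'n ^ 'n"
  shows "((\<lambda>s. matrix_exp (s *\<^sub>R A)) has_vector_derivative A ** matrix_exp (s *\<^sub>R A)) (at s)"
proof -
  have "((\<lambda>s. matrix_exp (s *\<^sub>R A) \<bullet> b) has_real_derivative (A ** matrix_exp (s *\<^sub>R A)) \<bullet> b) (at s)"
    for b :: "real ^ 'n ^ 'n"
  proof -
    define c where "c = (\<lambda>k. (matrix_power A k /\<^sub>R fact k) \<bullet> b)"
    have sums: "(\<lambda>k. c k * r ^ k) sums (matrix_exp (r *\<^sub>R A) \<bullet> b)" for r
      using bounded_linear.sums[OF bounded_linear_inner_left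
          summable_sums[OF summable_matrix_exp[of "r *\<^sub>R A"]], of b]
      by (simp add: c_def matrix_exp_def matrix_power_scaleR mult_ac)
    have "(\<lambda>k. (A ** (matrix_power (s *\<^sub>R A) k /\<^sub>R fact k)) \<bullet> b) sums
        ((A ** matrix_exp (s *\<^sub>R A)) \<bullet> b)"
      unfolding matrix_exp_def
      by (intro bounded_linear.sums[OF bounded_linear_inner_left]
          bounded_linear.sums[OF bounded_linear_matrix_mult_left]
          summable_sums summable_matrix_exp)
    \<comment> \<open>The factor \<open>A\<close> raises the power by one, and the factor
      \<open>k + 1\<close> in \<open>diffs\<close> turns \<open>1 / (k + 1)!\<close> into
      \<open>1 / k!\<close>.\<close>
    also have "(\<lambda>k. (A ** (matrix_power (s *\<^sub>R A) k /\<^sub>R fact k)) \<bullet> b) = (\<lambda>k. diffs c k * s ^ k)"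
      by (simp add: fun_eq_iff c_def diffs_def matrix_power_scaleR matrix_power_Suc
          matrix_mult_scaleR_right field_simps
          del: of_nat_Suc)
    finally have "(\<Sum>k. diffs c k * s ^ k) = (A ** matrix_exp (s *\<^sub>R A)) \<bullet> b"
      by (simp add: sums_iff)
    moreover have "(\<lambda>r. \<Sum>k. c k * r ^ k) = (\<lambda>r. matrix_exp (r *\<^sub>R A) \<bullet> b)"
      using sums by (simp add: sums_iff)
    ultimately show ?thesis
      using termdiffs_strong_converges_everywhere[of c s] sums by (auto simp: sums_iff)
  qed
  then show ?thesis
    unfolding has_vector_derivative_def
    by (subst has_derivative_componentwise_within)
      (auto simp: has_field_derivative_def mult_commute_abs)
qed

text \<open>Uniqueness for the linear equation: the product of \<open>e\<^bsup>(b-s)A\<^esup>\<close> and \<open>x s\<close> is constant.\<close>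

lemma linear_ode_left_limit:
  fixes A :: "real ^ 'n ^ 'n" and x :: "real \<Rightarrow> real ^ 'n"
  assumes "a < b"
    and deriv: "\<And>s. s \<in> {a..<b} \<Longrightarrow> (x has_vector_derivative A *v x s) (at s within {a..<b})"
    and lim: "(x \<longlongrightarrow> l) (at_left b)"
  shows "l = matrix_exp ((b - a) *\<^sub>R A) *v x a"
proof -
  \<comment> \<open>\<open>E s\<close> transports a state from time \<open>s\<close> to time
    \<open>b\<close> along the flow; in particular \<open>E b\<close> is the identity.\<close>
  define E where "E s = matrix_exp ((b - s) *\<^sub>R A)" for s
  have E: "(E has_vector_derivative - (A ** E s)) (at s within S)" for s S
  proof -
    have "((\<lambda>r. matrix_exp (r *\<^sub>R A)) \<circ> (\<lambda>s. b - s) has_vector_derivative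
        (- 1) *\<^sub>R (A ** matrix_exp ((b - s) *\<^sub>R A))) (at s within S)"
    proof (rule vector_diff_chain_within)
      show "((\<lambda>s. b - s) has_vector_derivative - 1) (at s within S)"
        using has_vector_derivative_diff[OF has_vector_derivative_const has_vector_derivative_id] by simp
      show "((\<lambda>r. matrix_exp (r *\<^sub>R A)) has_vector_derivative
          A ** matrix_exp ((b - s) *\<^sub>R A)) (at (b - s) within (\<lambda>s. b - s) ` S)"
        by (rule has_vector_derivative_at_within[OF has_vector_derivative_matrix_exp])
    qed
    then show ?thesis
      by (simp add: E_def[abs_def] o_def)
  qed
  have "((\<lambda>s. E s *v x s) has_vector_derivative 0) (at s within {a..<b})" if "s \<in> {a..<b}" for s
  proof -
    \<comment> \<open>The product rule puts \<open>A\<close> to the right of \<open>E s\<close> in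
      one term and to the left in the other; they cancel because the two commute.\<close>
    have "E s *v (A *v x s) + (- (A ** E s)) *v x s = 0"
      by (simp add: matrix_vector_mul_assoc E_def matrix_exp_commute[of A "b - s"]
          bounded_bilinear.minus_left[OF bounded_bilinear_matrix_vector_mult])
    then show ?thesis
      using bounded_bilinear.has_vector_derivative[OF bounded_bilinear_matrix_vector_mult E deriv[OF that]]
      by simp
  qed
  then obtain c where c: "\<And>s. s \<in> {a..<b} \<Longrightarrow> E s *v x s = c"
    using has_vector_derivative_zero_constant[of "{a..<b}" "\<lambda>s. E s *v x s"]
      convex_real_interval(7)[of a b] by metis
  \<comment> \<open>The value \<open>x b\<close> may already be the state after a jump, so the
    constant is evaluated at \<open>b\<close> through the left limit \<open>l\<close>.\<close>
  have "(E \<longlongrightarrow> E b) (at_left b)"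
    using has_vector_derivative_continuous[OF E] by (simp add: continuous_within)
  then have "((\<lambda>s. E s *v x s) \<longlongrightarrow> E b *v l) (at_left b)"
    by (rule bounded_bilinear.tendsto[OF bounded_bilinear_matrix_vector_mult _ lim])
  moreover have "((\<lambda>s. E s *v x s) \<longlongrightarrow> c) (at_left b)"
  proof (rule tendsto_eventually)
    show "\<forall>\<^sub>F s in at_left b. E s *v x s = c"
      using eventually_at_left_real[OF \<open>a < b\<close>] by eventually_elim (auto intro: c)
  qed
  ultimately have "E b *v l = c"
    by (rule tendsto_unique[OF trivial_limit_at_left_real])
  then show ?thesis
    using c[of a] \<open>a < b\<close> by (simp add: E_def)
qed

section \<open>Quadratic forms\<close>

lemma inner_matrix_vector_mult_transpose:
  fixes M :: "real ^ 'n ^ 'm"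
  shows "(M *v v) \<bullet> w = v \<bullet> (transpose M *v w)"
  by (metis dot_lmul_matrix vector_transpose_matrix inner_commute)

lemma loewner_leD: "A \<le>\<^sub>L B \<Longrightarrow> v \<bullet> (A *v v) \<le> v \<bullet> (B *v v)"
  by (simp add: loewner_le_def positive_semidefinite_def matrix_vector_mult_diff_rdistrib inner_diff_right)

text \<open>Only the zero vector is exempt from strict positivity, and there the form
  vanishes.\<close>

lemma loewner_less_imp_le: "A <\<^sub>L B \<Longrightarrow> A \<le>\<^sub>L B"
  unfolding loewner_less_def loewner_le_def positive_definite_def positive_semidefinite_def
  by (metis inner_zero_left less_eq_real_def)

text \<open>The form attains a positive minimum on the compact unit sphere, and homogeneity of
  degree two carries the bound to all vectors.\<close>

lemma positive_definite_lower_bound: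
  fixes Q :: "real ^ 'n ^ 'n"
  assumes "positive_definite Q"
  shows "\<exists>c>0. \<forall>v. c * (norm v)\<^sup>2 \<le> v \<bullet> (Q *v v)"
proof -
  have "compact (sphere (0 :: real ^ 'n) 1)" "sphere (0 :: real ^ 'n) 1 \<noteq> {}"
    by simp_all
  moreover have "continuous_on (sphere 0 1) (\<lambda>v. v \<bullet> (Q *v v))"
    by (intro continuous_on_inner continuous_on_id linear_continuous_on
        matrix_vector_mul_bounded_linear)
  ultimately obtain u where u: "u \<in> sphere 0 1"
    "\<And>v. v \<in> sphere 0 1 \<Longrightarrow> u \<bullet> (Q *v u) \<le> v \<bullet> (Q *v v)"
    using continuous_attains_inf[of "sphere 0 1" "\<lambda>v. v \<bullet> (Q *v v)"] by blast
  have "u \<bullet> (Q *v u) * (norm v)\<^sup>2 \<le> v \<bullet> (Q *v v)" for v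
  proof (cases "v = 0")
    case False
    have "u \<bullet> (Q *v u) \<le> (v /\<^sub>R norm v) \<bullet> (Q *v (v /\<^sub>R norm v))"
      using False by (intro u) simp
    also have "\<dots> = (v \<bullet> (Q *v v)) / (norm v)\<^sup>2"
      by (simp add: matrix_vector_mult_scaleR divide_inverse power2_eq_square)
    finally show ?thesis
      using False by (simp add: pos_le_divide_eq)
  qed simp
  moreover have "u \<noteq> 0"
    using u(1) by auto
  ultimately show ?thesis
    using assms unfolding positive_definite_def by blast
qed

text \<open>One constant must serve whichever mode is active at a later time. Each added form
  replaces the constant by a minimum of two positive numbers.\<close>

lemma positive_definite_family_lower_bound:
  fixes Q :: "'p \<Rightarrow> real ^ 'n ^ 'n"
  assumes "finite P" and "\<And>p. p \<in> P \<Longrightarrow> positive_definite (Q p)"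
  shows "\<exists>c>0. \<forall>p\<in>P. \<forall>v. c * (norm v)\<^sup>2 \<le> v \<bullet> (Q p *v v)"
  using assms
proof (induction P rule: finite_induct)
  case (insert p P)
  then obtain c where c: "c > 0" "\<And>p v. p \<in> P \<Longrightarrow> c * (norm v)\<^sup>2 \<le> v \<bullet> (Q p *v v)"
    by auto
  obtain d where d: "d > 0" "\<And>v. d * (norm v)\<^sup>2 \<le> v \<bullet> (Q p *v v)"
    using positive_definite_lower_bound[of "Q p"] insert.prems by auto
  have "min c d * (norm v)\<^sup>2 \<le> c * (norm v)\<^sup>2" "min c d * (norm v)\<^sup>2 \<le> d * (norm v)\<^sup>2"
    for v :: "real ^ 'n"
    by (simp_all add: mult_right_mono)
  then have "\<forall>q\<in>insert p P. \<forall>v. min c d * (norm v)\<^sup>2 \<le> v \<bullet> (Q q *v v)"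
    using c(2) d(2) by (metis insert_iff order_trans)
  then show ?case
    using c(1) d(1) by (intro exI[of _ "min c d"]) simp
qed (auto intro: exI[of _ 1])

lemma quadratic_form_upper_bound:
  fixes Q :: "real ^ 'n ^ 'n"
  shows "\<exists>K>0. \<forall>v. v \<bullet> (Q *v v) \<le> K * (norm v)\<^sup>2"
proof -
  obtain K where K: "K > 0" "\<And>v. norm (Q *v v) \<le> K * norm v"
    using linear_bounded_pos[of "(*v) Q"] by auto
  have "v \<bullet> (Q *v v) \<le> K * (norm v)\<^sup>2" for v
  proof -
    have "v \<bullet> (Q *v v) \<le> norm v * norm (Q *v v)"
      by (rule norm_cauchy_schwarz)
    also have "\<dots> \<le> norm v * (K * norm v)"
      by (intro mult_left_mono K) simp
    finally show ?thesis
      by (simp add: power2_eq_square mult_ac)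
  qed
  with K(1) show ?thesis by blast
qed

text \<open>Along a solution the form has derivative
  \<open>x u \<bullet> ((Q ** A + transpose A ** Q) *v x u)\<close>, which is nonpositive.\<close>

lemma lyapunov_nonincreasing:
  fixes A Q :: "real ^ 'n ^ 'n" and x :: "real \<Rightarrow> real ^ 'n"
  assumes le: "Q ** A + transpose A ** Q \<le>\<^sub>L 0"
    and deriv: "\<And>s. s \<in> {a..<b} \<Longrightarrow> (x has_vector_derivative A *v x s) (at s within {a..<b})"
    and "r \<in> {a..<b}" and "s \<in> {a..<b}" and "r \<le> s"
  shows "x s \<bullet> (Q *v x s) \<le> x r \<bullet> (Q *v x r)"
proof (rule DERIV_nonpos_imp_decreasing_open[OF \<open>r \<le> s\<close>])
  \<comment> \<open>If \<open>r = a\<close>, only a right derivative is available at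
    \<open>r\<close>; continuity covers the end points and the sign of the derivative is checked
    strictly between them.\<close>
  have "continuous_on {a..<b} x"
    unfolding continuous_on_eq_continuous_within
    by (intro ballI has_vector_derivative_continuous[OF deriv])
  then have "continuous_on {r..s} x"
    by (rule continuous_on_subset) (use assms(3,4) in auto)
  then show "continuous_on {r..s} (\<lambda>s. x s \<bullet> (Q *v x s))"
    by (intro continuous_on_inner bounded_linear.continuous_on[OF matrix_vector_mul_bounded_linear])
next
  fix u assume u: "r < u" "u < s"
  have "u \<in> interior {a..<b}"
    using u assms(3,4) by simp
  then have "at u within {a..<b} = at u"
    by (rule at_within_interior)
  then have x: "(x has_vector_derivative A *v x u) (at u)"
    using deriv[of u] u assms(3,4) by simp
  have "((\<lambda>s. x s \<bullet> (Q *v x s)) has_vector_derivative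
      x u \<bullet> (Q *v (A *v x u)) + (A *v x u) \<bullet> (Q *v x u)) (at u)"
    by (rule bounded_bilinear.has_vector_derivative[OF bounded_bilinear_inner x
          bounded_linear.has_vector_derivative[OF matrix_vector_mul_bounded_linear x]])
  moreover have "x u \<bullet> (Q *v (A *v x u)) + (A *v x u) \<bullet> (Q *v x u) =
      x u \<bullet> ((Q ** A + transpose A ** Q) *v x u)"
    by (simp add: inner_matrix_vector_mult_transpose matrix_vector_mult_add_rdistrib
        inner_add_right matrix_vector_mul_assoc)
  ultimately show "\<exists>y. ((\<lambda>s. x s \<bullet> (Q *v x s)) has_real_derivative y) (at u) \<and> y \<le> 0"
    using loewner_leD[OF le, of "x u"]
    by (intro exI conjI) (simp_all add: has_real_derivative_iff_has_vector_derivative)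
qed

section \<open>Switching signals\<close>

text \<open>Right-continuity at \<open>t n\<close> attaches the left end point to the open interval
  on which the signal is constant.\<close>

lemma switching_signal_constant:
  assumes "switching_signal P \<sigma> t" and "s \<in> {t n..<t (Suc n)}"
  shows "\<sigma> s = \<sigma> (t n)"
proof -
  have mono: "strict_mono t" and "t 0 = 0"
    and right: "\<And>s. s \<ge> 0 \<Longrightarrow> \<forall>\<^sub>F u in at_right s. \<sigma> u = \<sigma> s"
    and const: "\<And>k. k \<ge> 1 \<Longrightarrow> \<sigma> constant_on {t (k - 1)<..<t k}"
    using assms(1) by (auto simp: switching_signal_def)
  have "t n < t (Suc n)"
    using mono by (simp add: strict_mono_less)
  moreover have "t 0 \<le> t n"
    using mono by (simp add: strict_mono_less_eq)
  ultimately have "t n < t (Suc n)" "0 \<le> t n"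
    by (simp_all add: \<open>t 0 = 0\<close>)
  then have "\<forall>\<^sub>F u in at_right (t n). \<sigma> u = \<sigma> (t n) \<and> u \<in> {t n<..<t (Suc n)}"
    by (intro eventually_conj right eventually_at_right_real)
  then obtain u where "\<sigma> u = \<sigma> (t n)" "u \<in> {t n<..<t (Suc n)}"
    using eventually_happens[of _ "at_right (t n)"] trivial_limit_at_right_real by blast
  moreover obtain c where "\<And>v. v \<in> {t n<..<t (Suc n)} \<Longrightarrow> \<sigma> v = c"
    using const[of "Suc n"] by (auto simp: constant_on_def)
  ultimately show ?thesis
    using assms(2) by (cases "s = t n") auto
qed

text \<open>Since \<open>t\<close> diverges there is a least \<open>m\<close> with
  \<open>s < t m\<close>. It is not 0 because \<open>t 0 = 0 \<le> s\<close>, and its predecessor is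
  the required index.\<close>

lemma switching_signal_interval:
  assumes "switching_signal P \<sigma> t" and "s \<ge> 0"
  obtains n where "s \<in> {t n..<t (Suc n)}"
proof -
  have "t 0 = 0" and "filterlim t at_top sequentially"
    using assms(1) by (auto simp: switching_signal_def)
  then have "\<forall>\<^sub>F m in sequentially. s < t m"
    by (simp add: filterlim_at_top_dense)
  then have "\<exists>m. s < t m"
    by (rule eventually_happens'[OF sequentially_bot])
  then obtain m where m: "s < t m" "\<And>k. k < m \<Longrightarrow> \<not> s < t k"
    unfolding exists_least_iff[of "\<lambda>m. s < t m"] by blast
  then obtain n where "m = Suc n"
    using \<open>t 0 = 0\<close> \<open>s \<ge> 0\<close> by (cases m) auto
  with m(1) m(2)[of n] show ?thesis
    by (intro that[of n]) simp
qed

section \<open>Stability under arbitrary impulses\<close>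

theorem theorem4p4:
  fixes P :: "'p set" and QQ :: "'q set"
    and A :: "'p \<Rightarrow> real ^ 'n ^ 'n" and J :: "'q \<Rightarrow> real ^ 'n ^ 'n"
    and \<tau> :: real
  assumes "finite P"
    and "compact (J ` QQ)"
    and "\<tau> > 0"
    and "\<exists>Q :: 'p \<Rightarrow> real ^ 'n ^ 'n.
      (\<forall>p\<in>P. positive_definite (Q p)) \<and>
      (\<forall>p\<in>P. Q p ** A p + transpose (A p) ** Q p <\<^sub>L 0) \<and>
      (\<forall>p\<in>P. \<forall>q\<in>P. \<forall>M\<in>J ` QQ.
        matrix_exp (\<tau> *\<^sub>R transpose (A q)) ** transpose M ** Q p ** M ** matrix_exp (\<tau> *\<^sub>R A q)
          \<le>\<^sub>L Q q)"
  shows "\<forall>(\<sigma>, t) \<in> dwell_time_signals P \<tau>. \<forall>\<omega> \<in> t ` {1..} \<rightarrow> QQ.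
    impulsive_stable A J \<sigma> t \<omega>"
proof (intro ballI, clarify)
  fix \<sigma> :: "real \<Rightarrow> 'p" and t :: "nat \<Rightarrow> real" and \<omega> :: "real \<Rightarrow> 'q"
  assume dwell: "(\<sigma>, t) \<in> dwell_time_signals P \<tau>" and \<omega>: "\<omega> \<in> t ` {1..} \<rightarrow> QQ"
  obtain Q where pd: "\<And>p. p \<in> P \<Longrightarrow> positive_definite (Q p)"
    and lyap: "\<And>p. p \<in> P \<Longrightarrow> Q p ** A p + transpose (A p) ** Q p \<le>\<^sub>L 0"
    and jump: "\<And>p q M. \<lbrakk>p \<in> P; q \<in> P; M \<in> J ` QQ\<rbrakk> \<Longrightarrow>
      matrix_exp (\<tau> *\<^sub>R transpose (A q)) ** transpose M ** Q p ** M ** matrix_exp (\<tau> *\<^sub>R A q) \<le>\<^sub>L Q q"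
    using assms(4) loewner_less_imp_le by metis
  have sig: "switching_signal P \<sigma> t" and gap: "\<And>n. t (Suc n) - t n \<ge> \<tau>"
    using dwell by (force simp: dwell_time_signals_def)+
  have "t 0 = 0" and mono: "strict_mono t" and \<sigma>P: "\<And>s. s \<ge> 0 \<Longrightarrow> \<sigma> s \<in> P"
    using sig by (auto simp: switching_signal_def)
  have t_nonneg: "t n \<ge> 0" for n
    using mono \<open>t 0 = 0\<close> by (metis strict_mono_less_eq zero_le)
  have V_le: "x s \<bullet> (Q (\<sigma> s) *v x s) \<le> x 0 \<bullet> (Q (\<sigma> 0) *v x 0)"
    if sol: "impulsive_solution A J \<sigma> t \<omega> x" and "s \<ge> 0" for x s
  proof -
    let ?V = "\<lambda>s. x s \<bullet> (Q (\<sigma> s) *v x s)"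
    have deriv: "(x has_vector_derivative A (\<sigma> (t n)) *v x s) (at s within {t n..<t (Suc n)})"
      if "s \<in> {t n..<t (Suc n)}" for n s
    proof -
      have "\<forall>s\<in>{t (Suc n - 1)..<t (Suc n)}. (x has_vector_derivative A (\<sigma> s) *v x s)
          (at s within {t (Suc n - 1)..<t (Suc n)})"
        using sol unfolding impulsive_solution_def by (elim conjE allE[of _ "Suc n"]) simp
      then show ?thesis
        unfolding switching_signal_constant[OF sig that, symmetric] using that by simp
    qed
    have decr: "?V s \<le> ?V (t n)" if "s \<in> {t n..<t (Suc n)}" for n s
      unfolding switching_signal_constant[OF sig that]
      by (rule lyapunov_nonincreasing[OF lyap[OF \<sigma>P[OF t_nonneg]] deriv]) (use that in auto)
    \<comment> \<open>Induction over the switching times: flow from \<open>t n\<close> to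
      \<open>r\<close>, then flow for time \<open>\<tau>\<close> and the jump taken
      together.\<close>
    have "?V (t n) \<le> ?V 0" for n
    proof (induction n)
      case (Suc n)
      define B where "B = A (\<sigma> (t n))"
      define M where "M = J (\<omega> (t (Suc n)))"
      \<comment> \<open>Exactly \<open>\<tau>\<close> before the jump, to match the exponential in
        the hypothesis. The dwell time gives \<open>t n \<le> r\<close>, with equality
        allowed.\<close>
      define r where "r = t (Suc n) - \<tau>"
      have r: "r \<in> {t n..<t (Suc n)}"
        using gap[of n] \<open>\<tau> > 0\<close> by (simp add: r_def)
      have "\<exists>l. (x \<longlongrightarrow> l) (at_left (t (Suc n))) \<and> x (t (Suc n)) = M *v l"
        using sol unfolding impulsive_solution_def M_def by (elim conjE allE[of _ "Suc n"]) simp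
      then obtain l where l: "(x \<longlongrightarrow> l) (at_left (t (Suc n)))" "x (t (Suc n)) = M *v l"
        by blast
      have "l = matrix_exp ((t (Suc n) - r) *\<^sub>R B) *v x r"
      proof (rule linear_ode_left_limit[OF _ _ l(1)])
        show "(x has_vector_derivative B *v x s) (at s within {r..<t (Suc n)})"
          if "s \<in> {r..<t (Suc n)}" for s
          unfolding B_def
          by (rule has_vector_derivative_within_subset[OF deriv]) (use r that in auto)
      qed (use r in simp)
      then have x: "x (t (Suc n)) = M *v (matrix_exp (\<tau> *\<^sub>R B) *v x r)"
        by (simp add: l(2) r_def)
      have tr: "transpose (matrix_exp (\<tau> *\<^sub>R B)) = matrix_exp (\<tau> *\<^sub>R transpose B)"
        by (simp add: transpose_matrix_exp
            transpose_scaleR)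
      \<comment> \<open>This is the left side of the jump inequality with \<open>p\<close> the mode
        after the jump and \<open>q\<close> the mode before it.\<close>
      have "?V (t (Suc n)) = x r \<bullet> ((matrix_exp (\<tau> *\<^sub>R transpose B) ** transpose M **
          Q (\<sigma> (t (Suc n))) ** M ** matrix_exp (\<tau> *\<^sub>R B)) *v x r)"
        by (simp add: x inner_matrix_vector_mult_transpose tr matrix_vector_mul_assoc
            matrix_mul_assoc matrix_transpose_mul)
      also have "\<dots> \<le> x r \<bullet> (Q (\<sigma> (t n)) *v x r)"
        unfolding B_def M_def using \<omega> by (intro loewner_leD jump \<sigma>P t_nonneg) auto
      also have "\<dots> = ?V r"
        by (simp add: switching_signal_constant[OF sig r])
      also have "\<dots> \<le> ?V (t n)"
        by (rule decr[OF r])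
      finally show ?case
        using Suc by simp
    qed (simp add: \<open>t 0 = 0\<close>)
    moreover obtain n where "s \<in> {t n..<t (Suc n)}"
      using switching_signal_interval[OF sig \<open>s \<ge> 0\<close>] .
    ultimately show ?thesis
      using decr order_trans by blast
  qed
  obtain c where c: "c > 0" "\<And>p v. p \<in> P \<Longrightarrow> c * (norm v)\<^sup>2 \<le> v \<bullet> (Q p *v v)"
    using positive_definite_family_lower_bound[of P Q] \<open>finite P\<close> pd by blast
  \<comment> \<open>The signal is fixed, so the estimate starts from the single form of the initial
    mode.\<close>
  obtain K where K: "K > 0" "\<And>v. v \<bullet> (Q (\<sigma> 0) *v v) \<le> K * (norm v)\<^sup>2"
    using quadratic_form_upper_bound[of "Q (\<sigma> 0)"] by blast
  show "impulsive_stable A J \<sigma> t \<omega>"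
    unfolding impulsive_stable_def
  proof (intro allI impI)
    fix \<epsilon> :: real
    assume "\<epsilon> > 0"
    \<comment> \<open>Chosen so that
      \<open>K * \<delta>\<^sup>2 = c * \<epsilon>\<^sup>2\<close>.\<close>
    define \<delta> where "\<delta> = \<epsilon> * sqrt (c / K)"
    have "norm (x s) < \<epsilon>"
      if sol: "impulsive_solution A J \<sigma> t \<omega> x" and small: "norm (x 0) < \<delta>" and "s > 0" for x s
    proof -
      have "c * (norm (x s))\<^sup>2 \<le> x s \<bullet> (Q (\<sigma> s) *v x s)"
        using \<open>s > 0\<close> by (intro c \<sigma>P) simp
      also have "\<dots> \<le> x 0 \<bullet> (Q (\<sigma> 0) *v x 0)"
        using V_le[OF sol] \<open>s > 0\<close> by simp
      also have "\<dots> \<le> K * (norm (x 0))\<^sup>2"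
        by (rule K)
      also have "\<dots> < K * \<delta>\<^sup>2"
        using K(1) small by (simp add: power_strict_mono)
      also have "\<dots> = c * \<epsilon>\<^sup>2"
        using c(1) K(1) by (simp add: \<delta>_def power_mult_distrib)
      finally have "(norm (x s))\<^sup>2 < \<epsilon>\<^sup>2"
        using c(1) by simp
      then show ?thesis
        using \<open>\<epsilon> > 0\<close> by (simp add: power_less_imp_less_base)
    qed
    moreover have "\<delta> > 0"
      using \<open>\<epsilon> > 0\<close> c(1) K(1) by (simp add: \<delta>_def)
    ultimately show "\<exists>\<delta>>0. \<forall>x. impulsive_solution A J \<sigma> t \<omega> x \<longrightarrow> norm (x 0) < \<delta> \<longrightarrow>
        (\<forall>s>0. norm (x s) < \<epsilon>)"
      by blast
  qed
qed

end
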